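(* (Comparison Principle on $\mathrm{Int}(\hat S_d)$.) Suppose Assumption A holds (see context). Let $u,v\in\mathcal{C}([0,T]\times\hat S_d)$, and let $u$ be a viscosity subsolution and $v$ a viscosity supersolution, respectively, on $\mathrm{Int}(\hat S_d)$, of the Hamilton–Jacobi–Bellman equation $$-\partial_tw(t,x)+\hat{\mathcal{H}}(t,x,D_xw(t,x))=0 .$$ If $u(T,x)\le v(T,x)$ for every $x\in\hat S_d$, then $u(t,x)\le v(t,x)$ for every $t\in[0,T]$ and $x\in\hat S_d$.
   Context: **Notation.** $d\ge2$ is an integer, $T>0$, $S_d=\{m\in\mathbb{R}^d:m_i\ge0,\ \sum_im_i=1\}$, $\hat S_d=\{x\in\mathbb{R}^{d-1}:x_j\ge0,\ \sum_{j=1}^{d-1}x_j\le1\}$, $\mathrm{Int}(\hat S_d)$ is its interior in $\mathbb{R}^{d-1}$. For $x\in\hat S_d$, $x^{-d}=1-\sum_{j=1}^{d-1}x_j$ and $\check x=(x_1,\dots,x_{d-1},x^{-d})\in S_d$. $|\cdot|$ is the Euclidean norm. **Data.** Action space $A$, transition rates $Q_{i,j}:[0,T]\times A\times S_d\to[0,\infty)$, running costs $f^i:[0,T]\times A\times S_d\to\mathbb{R}$, terminal costs $g^i:S_d\to\mathbb{R}$, $i,j\in\{1,\dots,d\}$. Set $F(t,a^1,\dots,a^d,m)=\sum_im_if^i(t,a^i,m)$ and $G(m)=\sum_im_ig^i(m)$. **Assumption A.** (A1) $A$ is a compact metric space. (A2) Each $Q_{i,j}$ is continuous on $[0,T]\times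 A\times S_d$ and $|Q_{i,j}(t,a,m)-Q_{i,j}(s,a,p)|\le C(|t-s|+|m-p|)$ with $C$ independent of $a$. (A3) $F$ is continuous on $[0,T]\times A^d\times S_d$, $|F(t,a,m)-F(s,a,p)|\le C(|t-s|+|m-p|)$ with $C$ independent of $a\in A^d$, and $|G(m)-G(p)|\le C|m-p|$. **Hamiltonian.** For $z\in\mathbb{R}^d$ with $z_i=0$, $H^i(t,m,z)=\max_{a\in A}\{-\langle Q_{i,\bullet}(t,a,m),z\rangle-f^i(t,a,m)\}$, where $Q_{i,\bullet}$ is the $i$-th row of $Q$. For $w\in\mathbb{R}^{d-1}$, $$\hat H^i(t,x,w)=H^i(t,\check x,(w_1-w_i,\dots,w_{d-1}-w_i,-w_i))\ (1\le i\le d-1),\qquad\hat H^d(t,x,w)=H^d(t,\check x,(w_1,\dots,w_{d-1},0)),$$ $$\hat{\mathcal{H}}(t,x,w)=\sum_{i=1}^{d-1}x_i\hat H^i(t,x,w)+x^{-d}\hat H^d(t,x,w).$$ **Viscosity sub/supersolutions on $\mathrm{Int}(\hat S_d)$.** A continuous function $u$ is a viscosity subsolution (resp. supersolution) of the equation on $\mathrm{Int}(\hat S_d)$ if for every $\phi\in\mathcal{C}^1([0,T)\times\mathrm{Int}(\hat S_d))$ one has $-\partial_t\phi(\bar t,\bar x)+\hat{\mathcal{H}}(\bar t,\bar x,D_x\phi(\bar t,\bar x))\le0$ (resp. $\ge0$) at every $(\bar t,\bar x)\in[0,T)\times\mathrm{Int}(\hat S_d)$ which is a local maximum (resp. minimum)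 of $u-\phi$ on $[0,T)\times\mathrm{Int}(\hat S_d)$. No boundary condition is imposed on $\partial\hat S_d$. *)

theory Defs
  imports "HOL-Analysis.Analysis"
begin

(* The d states are the elements of 'n option, where 'n is a finite type with d - 1 elements:
   Some k stands for one of the states 1, ..., d - 1 and None stands for the last state d.
   So R^(d-1) is real ^ 'n, R^d is real ^ 'n option, and d = CARD('n option) ranges over
   all integers >= 2. *)

definition prob_simplex :: "(real ^ 'i::finite) set" where
  "prob_simplex = {m. (\<forall>i. 0 \<le> m $ i) \<and> (\<Sum>i\<in>UNIV. m $ i) = 1}"

definition hat_simplex :: "(real ^ 'n::finite) set" where
  "hat_simplex = {x. (\<forall>j. 0 \<le> x $ j) \<and> (\<Sum>j\<in>UNIV. x $ j) \<le> 1}"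

definition last_coord :: "real ^ 'n::finite \<Rightarrow> real" where
  "last_coord x = 1 - (\<Sum>j\<in>UNIV. x $ j)"

definition check_pt :: "real ^ 'n::finite \<Rightarrow> real ^ 'n option" where
  "check_pt x = (\<chi> i. case i of Some k \<Rightarrow> x $ k | None \<Rightarrow> last_coord x)"

(* The argument order is Q i j t a m, f i t a m and g i m. *)

definition run_cost ::
  "('i::finite \<Rightarrow> real \<Rightarrow> 'a \<Rightarrow> real ^ 'i \<Rightarrow> real) \<Rightarrow>
   real \<Rightarrow> 'a ^ 'i \<Rightarrow> real ^ 'i \<Rightarrow> real" where
  "run_cost f t a m = (\<Sum>i\<in>UNIV. m $ i * f i t (a $ i) m)"

definition term_cost ::
  "('i::finite \<Rightarrow> real ^ 'i \<Rightarrow> real) \<Rightarrow> real ^ 'i \<Rightarrow> real" where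
  "term_cost g m = (\<Sum>i\<in>UNIV. m $ i * g i m)"

definition action_profiles :: "'a set \<Rightarrow> ('a ^ 'i::finite) set" where
  "action_profiles A = {a. \<forall>i. a $ i \<in> A}"

definition transition_rates ::
  "'a set \<Rightarrow> real \<Rightarrow>
   ('i::finite \<Rightarrow> 'i \<Rightarrow> real \<Rightarrow> 'a \<Rightarrow> real ^ 'i \<Rightarrow> real) \<Rightarrow> bool" where
  "transition_rates A T Q \<longleftrightarrow>
     (\<forall>i j. \<forall>t\<in>{0..T}. \<forall>a\<in>A. \<forall>m\<in>prob_simplex. 0 \<le> Q i j t a m)"

(* Nonemptiness of A is implicit in the maximum over A in the Hamiltonian. No continuity of the
   single costs f i is required, only that of the weighted sum run_cost f. *)

definition assumption_A ::
  "'a::metric_space set \<Rightarrow> real \<Rightarrow>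
   ('i::finite \<Rightarrow> 'i \<Rightarrow> real \<Rightarrow> 'a \<Rightarrow> real ^ 'i \<Rightarrow> real) \<Rightarrow>
   ('i \<Rightarrow> real \<Rightarrow> 'a \<Rightarrow> real ^ 'i \<Rightarrow> real) \<Rightarrow>
   ('i \<Rightarrow> real ^ 'i \<Rightarrow> real) \<Rightarrow> bool" where
  "assumption_A A T Q f g \<longleftrightarrow>
     compact A \<and> A \<noteq> {} \<and>
     (\<forall>i j. continuous_on ({0..T} \<times> A \<times> prob_simplex) (\<lambda>(t, a, m). Q i j t a m)) \<and>
     (\<exists>C. \<forall>i j. \<forall>a\<in>A. \<forall>t\<in>{0..T}. \<forall>s\<in>{0..T}. \<forall>m\<in>prob_simplex. \<forall>p\<in>prob_simplex.
        \<bar>Q i j t a m - Q i j s a p\<bar> \<le> C * (\<bar>t - s\<bar> + norm (m - p))) \<and>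
     continuous_on ({0..T} \<times> action_profiles A \<times> prob_simplex) (\<lambda>(t, a, m). run_cost f t a m) \<and>
     (\<exists>C. \<forall>a\<in>action_profiles A. \<forall>t\<in>{0..T}. \<forall>s\<in>{0..T}. \<forall>m\<in>prob_simplex. \<forall>p\<in>prob_simplex.
        \<bar>run_cost f t a m - run_cost f s a p\<bar> \<le> C * (\<bar>t - s\<bar> + norm (m - p))) \<and>
     (\<exists>C. \<forall>m\<in>prob_simplex. \<forall>p\<in>prob_simplex. \<bar>term_cost g m - term_cost g p\<bar> \<le> C * norm (m - p))"

definition ham_integrand ::
  "('i::finite \<Rightarrow> 'i \<Rightarrow> real \<Rightarrow> 'a \<Rightarrow> real ^ 'i \<Rightarrow> real) \<Rightarrow>
   ('i \<Rightarrow> real \<Rightarrow> 'a \<Rightarrow> real ^ 'i \<Rightarrow> real) \<Rightarrow>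
   'i \<Rightarrow> real \<Rightarrow> real ^ 'i \<Rightarrow> real ^ 'i \<Rightarrow> 'a \<Rightarrow> real" where
  "ham_integrand Q f i t m z a = - ((\<chi> j. Q i j t a m) \<bullet> z) - f i t a m"

(* The maximum over A, written as a supremum: see hamiltonian_is_max below. *)

definition hamiltonian ::
  "'a set \<Rightarrow> ('i::finite \<Rightarrow> 'i \<Rightarrow> real \<Rightarrow> 'a \<Rightarrow> real ^ 'i \<Rightarrow> real) \<Rightarrow>
   ('i \<Rightarrow> real \<Rightarrow> 'a \<Rightarrow> real ^ 'i \<Rightarrow> real) \<Rightarrow>
   'i \<Rightarrow> real \<Rightarrow> real ^ 'i \<Rightarrow> real ^ 'i \<Rightarrow> real" where
  "hamiltonian A Q f i t m z = (SUP a\<in>A. ham_integrand Q f i t m z a)"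

definition hat_hamiltonian ::
  "'a set \<Rightarrow>
   ('n::finite option \<Rightarrow> 'n option \<Rightarrow> real \<Rightarrow> 'a \<Rightarrow> real ^ 'n option \<Rightarrow> real) \<Rightarrow>
   ('n option \<Rightarrow> real \<Rightarrow> 'a \<Rightarrow> real ^ 'n option \<Rightarrow> real) \<Rightarrow>
   'n option \<Rightarrow> real \<Rightarrow> real ^ 'n \<Rightarrow> real ^ 'n \<Rightarrow> real" where
  "hat_hamiltonian A Q f i t x w =
     (case i of
        Some k \<Rightarrow> hamiltonian A Q f (Some k) t (check_pt x)
                    (\<chi> j. case j of Some l \<Rightarrow> w $ l - w $ k | None \<Rightarrow> - w $ k)
      | None \<Rightarrow> hamiltonian A Q f None t (check_pt x)
                    (\<chi> j. case j of Some l \<Rightarrow> w $ l | None \<Rightarrow> 0))"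

definition total_hamiltonian ::
  "'a set \<Rightarrow>
   ('n::finite option \<Rightarrow> 'n option \<Rightarrow> real \<Rightarrow> 'a \<Rightarrow> real ^ 'n option \<Rightarrow> real) \<Rightarrow>
   ('n option \<Rightarrow> real \<Rightarrow> 'a \<Rightarrow> real ^ 'n option \<Rightarrow> real) \<Rightarrow>
   real \<Rightarrow> real ^ 'n \<Rightarrow> real ^ 'n \<Rightarrow> real" where
  "total_hamiltonian A Q f t x w =
     (\<Sum>k\<in>UNIV. x $ k * hat_hamiltonian A Q f (Some k) t x w)
     + last_coord x * hat_hamiltonian A Q f None t x w"

lemma hamiltonian_is_max:
  assumes "assumption_A A T Q f g" "t \<in> {0..T}" "m \<in> prob_simplex" "0 < m $ i"
  shows "\<exists>a\<in>A. hamiltonian A Q f i t m z = ham_integrand Q f i t m z a \<and>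
           (\<forall>b\<in>A. ham_integrand Q f i t m z b \<le> ham_integrand Q f i t m z a)"
proof -
  have A: "compact A" "A \<noteq> {}"
    and Q: "\<And>i j. continuous_on ({0..T} \<times> A \<times> prob_simplex) (\<lambda>(t, a, m). Q i j t a m)"
    and F: "continuous_on ({0..T} \<times> action_profiles A \<times> prob_simplex)
              (\<lambda>(t, a, m). run_cost f t a m)"
    using assms(1) by (auto simp: assumption_A_def)
  obtain a0 where a0: "a0 \<in> A" using A by auto
  define pr where "pr a = (\<chi> j. if j = i then a else a0)" for a
  define c where "c = (\<Sum>j\<in>UNIV - {i}. m $ j * f j t a0 m)"
  have rc: "run_cost f t (pr a) m = m $ i * f i t a m + c" for a
    unfolding run_cost_def c_def
    by (subst sum.remove[of UNIV i]) (auto simp: pr_def intro!: sum.cong)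
  have "continuous_on A (\<lambda>a. if j = i then a else a0)" for j
    by (cases "j = i") (auto intro: continuous_intros)
  then have "continuous_on A (\<lambda>a. (t, pr a, m))"
    unfolding pr_def by (intro continuous_intros) auto
  then have "continuous_on A (\<lambda>a. run_cost f t (pr a) m)"
    using continuous_on_compose2[OF F, of A "\<lambda>a. (t, pr a, m)"] assms(2,3) a0
    by (force simp: action_profiles_def pr_def)
  then have "continuous_on A (\<lambda>a. (run_cost f t (pr a) m - c) / m $ i)"
    using assms(4) by (intro continuous_intros) auto
  then have cf: "continuous_on A (\<lambda>a. f i t a m)"
    using assms(4) by (simp add: rc)
  have cq: "continuous_on A (\<lambda>a. Q i j t a m)" for j
    using continuous_on_compose2[OF Q, of A "\<lambda>a. (t, a, m)"] assms(2,3)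
    by (force intro: continuous_intros)
  have "continuous_on A (ham_integrand Q f i t m z)"
    unfolding ham_integrand_def by (intro continuous_intros cf cq)
  then obtain a where a: "a \<in> A"
      "\<forall>b\<in>A. ham_integrand Q f i t m z b \<le> ham_integrand Q f i t m z a"
    using continuous_attains_sup[OF A] by blast
  then have "hamiltonian A Q f i t m z = ham_integrand Q f i t m z a"
    unfolding hamiltonian_def by (intro cSup_eq_maximum) auto
  with a show ?thesis by blast
qed

(* phi is C^1 on {0..<T} x U with time derivative pt and spatial gradient px;
   at time 0 the time derivative is the one-sided one. *)

definition C1_test ::
  "real \<Rightarrow> ('b::euclidean_space) set \<Rightarrow> (real \<times> 'b \<Rightarrow> real) \<Rightarrow>
   (real \<times> 'b \<Rightarrow> real) \<Rightarrow> (real \<times> 'b \<Rightarrow> 'b) \<Rightarrow> bool" where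
  "C1_test T U \<phi> pt px \<longleftrightarrow>
     (\<forall>t\<in>{0..<T}. \<forall>x\<in>U.
        ((\<lambda>s. \<phi> (s, x)) has_real_derivative pt (t, x)) (at t within {0..<T}) \<and>
        GDERIV (\<lambda>y. \<phi> (t, y)) x :> px (t, x)) \<and>
     continuous_on ({0..<T} \<times> U) pt \<and> continuous_on ({0..<T} \<times> U) px"

definition local_max_on :: "'b::metric_space set \<Rightarrow> ('b \<Rightarrow> real) \<Rightarrow> 'b \<Rightarrow> bool" where
  "local_max_on D h p \<longleftrightarrow> p \<in> D \<and> (\<exists>e>0. \<forall>q\<in>D. dist q p < e \<longrightarrow> h q \<le> h p)"

definition local_min_on :: "'b::metric_space set \<Rightarrow> ('b \<Rightarrow> real) \<Rightarrow> 'b \<Rightarrow> bool" where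
  "local_min_on D h p \<longleftrightarrow> p \<in> D \<and> (\<exists>e>0. \<forall>q\<in>D. dist q p < e \<longrightarrow> h p \<le> h q)"

(* Sub- and supersolutions of  - d/dt w + K(t, x, D_x w) = 0  on {0..<T} x U, U open. *)

definition viscosity_subsolution ::
  "real \<Rightarrow> ('b::euclidean_space) set \<Rightarrow> (real \<Rightarrow> 'b \<Rightarrow> 'b \<Rightarrow> real) \<Rightarrow>
   (real \<times> 'b \<Rightarrow> real) \<Rightarrow> bool" where
  "viscosity_subsolution T U K u \<longleftrightarrow>
     continuous_on ({0..<T} \<times> U) u \<and>
     (\<forall>\<phi> pt px. C1_test T U \<phi> pt px \<longrightarrow>
        (\<forall>t x. local_max_on ({0..<T} \<times> U) (\<lambda>q. u q - \<phi> q) (t, x) \<longrightarrow>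
           - pt (t, x) + K t x (px (t, x)) \<le> 0))"

definition viscosity_supersolution ::
  "real \<Rightarrow> ('b::euclidean_space) set \<Rightarrow> (real \<Rightarrow> 'b \<Rightarrow> 'b \<Rightarrow> real) \<Rightarrow>
   (real \<times> 'b \<Rightarrow> real) \<Rightarrow> bool" where
  "viscosity_supersolution T U K v \<longleftrightarrow>
     continuous_on ({0..<T} \<times> U) v \<and>
     (\<forall>\<phi> pt px. C1_test T U \<phi> pt px \<longrightarrow>
        (\<forall>t x. local_min_on ({0..<T} \<times> U) (\<lambda>q. v q - \<phi> q) (t, x) \<longrightarrow>
           - pt (t, x) + K t x (px (t, x)) \<ge> 0))"

end

theory Submission
  imports Defs
begin

text \<open>Doubling of variables with a barrier at the boundary. Writing \<open>m\<close> for the point of the simplex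
  with chart coordinates \<open>x\<close>, the function \<open>h x = - (\<Sum>i. ln (m\<^sub>i))\<close> blows up at the boundary. Since mass
  leaves state \<open>i\<close> at a rate at most proportional to \<open>m\<^sub>i\<close>, \<open>h\<close> grows at a bounded rate along every
  controlled flow, so adding \<open>l * D h\<close> to the momentum lowers the Hamiltonian by at most a constant
  times \<open>l\<close>. Penalising \<open>u (t, x) - v (s, y)\<close> with \<open>l * (h x + h y)\<close> therefore keeps the maximum points
  in the interior, where the equation is available, at a cost that is absorbed by a small linear
  penalty in time. The result extends to the closed simplex by continuity.\<close>

section \<open>Comparison on an open set that carries a barrier\<close>

text \<open>Provides the test functions for both solutions. The parameters \<open>k\<close>,
  \<open>l\<close>, \<open>e\<close> carry no sign condition because the supersolution is tested
  with all three negated. The squared product norm splits into a time part and a space part, which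
  gives the two derivatives.\<close>

lemma C1_test_quadratic_barrier:
  fixes U :: "'b::euclidean_space set"
  assumes dh: "\<And>x. x \<in> U \<Longrightarrow> GDERIV h x :> dh x" and cont: "continuous_on U dh"
  shows "C1_test T U (\<lambda>z. k * (norm (z - q))\<^sup>2 / 2 + l * h (snd z) - e * fst z)
    (\<lambda>z. k * (fst z - fst q) - e) (\<lambda>z. k *\<^sub>R (snd z - snd q) + l *\<^sub>R dh (snd z))"
proof -
  have eq: "(\<lambda>z. k * (norm (z - q))\<^sup>2 / 2 + l * h (snd z) - e * fst z) =
     (\<lambda>z. k * ((fst z - fst q)\<^sup>2 + (snd z - snd q) \<bullet> (snd z - snd q)) / 2 + l * h (snd z) - e * fst z)"
    by (simp add: norm_prod_def power2_norm_eq_inner fun_eq_iff)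
  have 1: "((\<lambda>s. k * ((s - fst q)\<^sup>2 + (x - snd q) \<bullet> (x - snd q)) / 2 + l * h x - e * s)
      has_real_derivative k * (t - fst q) - e) (at t within {0..<T})" for t x
    by (auto intro!: derivative_eq_intros)
  have 2: "GDERIV (\<lambda>y. k * ((t - fst q)\<^sup>2 + (y - snd q) \<bullet> (y - snd q)) / 2 + l * h y - e * t) x
      :> k *\<^sub>R (x - snd q) + l *\<^sub>R dh x" if "x \<in> U" for t x
    using dh[OF that] unfolding gderiv_def
    by (auto intro!: derivative_eq_intros simp: fun_eq_iff inner_simps inner_commute field_simps)
  have "continuous_on ({0..<T} \<times> U) (\<lambda>z. dh (snd z))"
    by (rule continuous_on_compose2[OF cont]) (auto intro!: continuous_intros)
  then show ?thesis
    unfolding eq C1_test_def using 1 2 by (auto intro!: continuous_intros)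
qed

text \<open>The last hypothesis on \<open>K\<close> replaces the usual modulus of continuity:
  shifting the momentum by \<open>l *\<^sub>R dh\<close> at the two points, with opposite signs, may
  cost only \<open>C * l\<close>, however large \<open>dh\<close> is near the boundary. Compact
  sublevel sets of \<open>h\<close> let the doubled function attain its maximum inside
  \<open>U\<close>.\<close>

lemma comparison_with_barrier:
  fixes U X :: "'b::euclidean_space set" and K :: "real \<Rightarrow> 'b \<Rightarrow> 'b \<Rightarrow> real"
  assumes "0 < T" and X: "compact X" "U \<subseteq> X"
    and cu: "continuous_on ({0..T} \<times> X) u" and cv: "continuous_on ({0..T} \<times> X) v"
    and sub: "viscosity_subsolution T U K u" and super: "viscosity_supersolution T U K v"
    and terminal: "\<And>x. x \<in> U \<Longrightarrow> u (T, x) \<le> v (T, x)"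
    and dh: "\<And>x. x \<in> U \<Longrightarrow> GDERIV h x :> dh x" and cdh: "continuous_on U dh"
    and h0: "\<And>x. x \<in> U \<Longrightarrow> 0 \<le> h x" and hcompact: "\<And>c. compact {x \<in> U. h x \<le> c}"
    and C: "0 \<le> C"
    and struct: "\<And>t s x y p l. \<lbrakk>t \<in> {0..<T}; s \<in> {0..<T}; x \<in> U; y \<in> U; 0 \<le> l\<rbrakk> \<Longrightarrow>
      K s y (p - l *\<^sub>R dh y) - K t x (p + l *\<^sub>R dh x)
        \<le> C * (1 + norm p) * (\<bar>t - s\<bar> + norm (x - y)) + C * l"
    and "t0 \<in> {0..T}" and "x0 \<in> U"
  shows "u (t0, x0) \<le> v (t0, x0)"
proof (rule ccontr)
  define th where "th = u (t0, x0) - v (t0, x0)"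
  assume "\<not> u (t0, x0) \<le> v (t0, x0)"
  then have th: "0 < th" by (simp add: th_def)
  have cptX: "compact ({0..T} \<times> X)" using X by (intro compact_Times) auto
  obtain Mu where Mu: "\<And>z. z \<in> {0..T} \<times> X \<Longrightarrow> \<bar>u z\<bar> \<le> Mu"
    using compact_imp_bounded[OF compact_continuous_image[OF cu cptX]] by (auto simp: bounded_iff)
  obtain Mv where Mv: "\<And>z. z \<in> {0..T} \<times> X \<Longrightarrow> \<bar>v z\<bar> \<le> Mv"
    using compact_imp_bounded[OF compact_continuous_image[OF cv cptX]] by (auto simp: bounded_iff)
  define M where "M = 1 + \<bar>Mu\<bar> + \<bar>Mv\<bar>"
  have M: "\<bar>u z\<bar> \<le> M" "\<bar>v z\<bar> \<le> M" if "z \<in> {0..T} \<times> X" for z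
    using Mu[OF that] Mv[OF that] by (auto simp: M_def)
  have M0: "0 < M" by (simp add: M_def)
  \<comment> \<open>The two time penalties and the two barrier terms at \<open>(t0, x0)\<close> each
    cost at most \<open>th / 8\<close>, so half of \<open>th\<close> survives.\<close>
  define eta where "eta = th / (8 * T)"
  have eta: "0 < eta" "eta * T = th / 8" using th \<open>0 < T\<close> by (auto simp: eta_def)
  \<comment> \<open>The first bound controls the barrier at \<open>x0\<close>; the second yields
    \<open>C * l < eta\<close>.\<close>
  define l where "l = min (th / (8 * (h x0 + 1))) (eta / (C + 1))"
  have hx0: "0 \<le> h x0" using h0 \<open>x0 \<in> U\<close> by simp
  have l0: "0 < l" using th eta C hx0 by (auto simp: l_def)
  have lC: "C * l < eta"
  proof -
    have "l \<le> eta / (C + 1)" by (simp add: l_def)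
    then have "l * (C + 1) \<le> eta" using C by (simp add: field_simps)
    then show ?thesis using l0 by (simp add: algebra_simps)
  qed
  have lh: "l * h x0 \<le> th / 8"
  proof -
    have "l \<le> th / (8 * (h x0 + 1))" by (simp add: l_def)
    then have "l * (h x0 + 1) \<le> th / 8" using hx0 by (simp add: field_simps)
    then show ?thesis using l0 by (simp add: algebra_simps)
  qed
  \<comment> \<open>The bound \<open>th / 4\<close> will keep the maximum point away from the
    terminal time; the other makes the error \<open>6 * C * rho\<close> from the doubling at most
    \<open>eta\<close>.\<close>
  define rho where "rho = min (th / 4) (eta / (6 * (C + 1)))"
  have rho0: "0 < rho" using th eta C by (auto simp: rho_def)
  have rho_th: "rho \<le> th / 4" unfolding rho_def by (rule min.cobounded1)
  have rhoC: "6 * C * rho \<le> eta"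
  proof -
    have "rho \<le> eta / (6 * (C + 1))" by (simp add: rho_def)
    then have "rho * (6 * (C + 1)) \<le> eta" using C by (simp add: field_simps)
    then show ?thesis using rho0 by (simp add: algebra_simps)
  qed
  have ucu: "uniformly_continuous_on ({0..T} \<times> X) u" and ucv: "uniformly_continuous_on ({0..T} \<times> X) v"
    using cu cv cptX by (auto intro: compact_uniformly_continuous)
  obtain d1 where d1: "0 < d1"
    "\<And>z z'. \<lbrakk>z \<in> {0..T} \<times> X; z' \<in> {0..T} \<times> X; dist z' z < d1\<rbrakk> \<Longrightarrow> dist (u z') (u z) < rho"
    using uniformly_continuous_onE[OF ucu rho0] by blast
  obtain d2 where d2: "0 < d2"
    "\<And>z z'. \<lbrakk>z \<in> {0..T} \<times> X; z' \<in> {0..T} \<times> X; dist z' z < d2\<rbrakk> \<Longrightarrow> dist (v z') (v z) < rho"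
    using uniformly_continuous_onE[OF ucv rho0] by blast
  \<comment> \<open>Including \<open>rho\<close> in the minimum lets the distance of the doubled
    points itself be estimated by \<open>rho\<close>.\<close>
  define d where "d = min (min d1 d2) rho"
  have uc: "\<bar>u z - u z'\<bar> < rho" "\<bar>v z - v z'\<bar> < rho"
    if "z \<in> {0..T} \<times> X" "z' \<in> {0..T} \<times> X" "norm (z - z') < d" for z z'
    using d1(2)[OF that(2,1)] d2(2)[OF that(2,1)] that(3) by (auto simp: dist_norm d_def)
  have d: "0 < d" "d \<le> rho" using d1(1) d2(1) rho0 by (auto simp: d_def)
  \<comment> \<open>Large enough that a penalty \<open>k * D\<^sup>2\<close> of at most
    \<open>4 * M\<close> forces \<open>D < d\<close>.\<close>
  define k where "k = 4 * M / d\<^sup>2 + 1"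
  have k0: "0 < k" using M0 by (simp add: k_def add_nonneg_pos)
  have kd: "4 * M < k * d\<^sup>2" using d by (simp add: k_def algebra_simps)

  define \<Phi> where "\<Phi> z q = u z - v q - k * (norm (z - q))\<^sup>2 / 2 - l * (h (snd z) + h (snd q))
      - eta * (T - fst z) - eta * (T - fst q)" for z q :: "real \<times> 'b"
  \<comment> \<open>If one point lies outside \<open>L\<close>, the barrier term exceeds
    \<open>2 * M\<close>, an upper bound for \<open>u z - v q\<close>, and the doubled function is
    negative. The search for a maximum thus reduces to a compact set.\<close>
  define L where "L = {x \<in> U. h x \<le> 2 * M / l}"
  have outside: "\<Phi> (t, x) (s, y) < 0"
    if "t \<in> {0..T}" "s \<in> {0..T}" "x \<in> U" "y \<in> U" "x \<notin> L \<or> y \<notin> L" for t s x y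
  proof -
    have "2 * M / l < h x + h y" using that h0[of x] h0[of y] by (auto simp: L_def)
    then have "2 * M < l * (h x + h y)" using l0 by (simp add: field_simps)
    moreover have "0 \<le> eta * (T - t)" "0 \<le> eta * (T - s)" "0 \<le> k * (norm ((t, x) - (s, y)))\<^sup>2 / 2"
      using that eta k0 by auto
    moreover have "\<bar>u (t, x)\<bar> \<le> M" "\<bar>v (s, y)\<bar> \<le> M" using M that X by blast+
    ultimately show ?thesis unfolding \<Phi>_def fst_conv snd_conv by linarith
  qed
  have start: "th / 2 \<le> \<Phi> (t0, x0) (t0, x0)"
  proof -
    have "eta * (T - t0) \<le> eta * T" using eta \<open>t0 \<in> {0..T}\<close> by (intro mult_left_mono) auto
    then have "eta * (T - t0) \<le> th / 8" using eta by simp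
    then show ?thesis using lh by (simp add: \<Phi>_def th_def[symmetric] algebra_simps)
  qed
  then have x0L: "x0 \<in> L" using outside[of t0 t0 x0 x0] \<open>x0 \<in> U\<close> \<open>t0 \<in> {0..T}\<close> th by force
  have LX: "L \<subseteq> X" "L \<subseteq> U" using X by (auto simp: L_def)
  have ch: "continuous_on L h"
    using dh LX by (intro continuous_at_imp_continuous_on ballI has_derivative_continuous) (auto simp: gderiv_def)
  have "continuous_on (({0..T} \<times> L) \<times> ({0..T} \<times> L)) (\<lambda>w. \<Phi> (fst w) (snd w))"
    unfolding \<Phi>_def
    by (intro continuous_intros continuous_on_compose2[OF cu] continuous_on_compose2[OF cv]
        continuous_on_compose2[OF ch]) (use LX in auto)
  moreover have "compact (({0..T} \<times> L) \<times> ({0..T} \<times> L))"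
    unfolding L_def by (intro compact_Times hcompact) auto
  moreover have "(({0..T} \<times> L) \<times> ({0..T} \<times> L)) \<noteq> {}" using x0L \<open>0 < T\<close> by auto
  ultimately obtain w where w: "w \<in> ({0..T} \<times> L) \<times> ({0..T} \<times> L)"
    and wmax: "\<forall>w'\<in>({0..T} \<times> L) \<times> ({0..T} \<times> L). \<Phi> (fst w') (snd w') \<le> \<Phi> (fst w) (snd w)"
    using continuous_attains_sup[of "({0..T} \<times> L) \<times> ({0..T} \<times> L)" "\<lambda>w. \<Phi> (fst w) (snd w)"] by blast
  obtain t x s y where wd: "w = ((t, x), (s, y))" by (metis surj_pair)
  have mem: "t \<in> {0..T}" "x \<in> L" "s \<in> {0..T}" "y \<in> L" using w wd by auto
  then have memX: "(t, x) \<in> {0..T} \<times> X" "(s, y) \<in> {0..T} \<times> X"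
    and memU: "x \<in> U" "y \<in> U" using LX by auto
  have wmax': "\<Phi> z q \<le> \<Phi> (t, x) (s, y)" if "z \<in> {0..T} \<times> L" "q \<in> {0..T} \<times> L" for z q
    using bspec[OF wmax, of "(z, q)"] that by (simp add: wd)
  have big: "th / 2 \<le> \<Phi> (t, x) (s, y)"
    using wmax'[of "(t0, x0)" "(t0, x0)"] start x0L \<open>t0 \<in> {0..T}\<close> by auto
  have max: "\<Phi> z q \<le> \<Phi> (t, x) (s, y)" if "z \<in> {0..T} \<times> U" "q \<in> {0..T} \<times> U" for z q
  proof (cases "snd z \<in> L \<and> snd q \<in> L")
    case True
    then show ?thesis using that by (intro wmax') auto
  next
    case False
    then have "\<Phi> z q < 0" using outside[of "fst z" "fst q" "snd z" "snd q"] that by auto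
    then show ?thesis using big th by linarith
  qed

  define D where "D = norm ((t, x) - (s, y))"
  \<comment> \<open>Comparing twice the maximum with both diagonal values cancels the barrier and the
    time penalties, so no bound on the barrier at the maximum point is needed.\<close>
  have diag: "k * D\<^sup>2 \<le> u (t, x) - u (s, y) + (v (t, x) - v (s, y))"
  proof -
    have "\<Phi> (t, x) (t, x) + \<Phi> (s, y) (s, y) \<le> 2 * \<Phi> (t, x) (s, y)"
      using max[of "(t, x)" "(t, x)"] max[of "(s, y)" "(s, y)"] mem memU by auto
    then show ?thesis by (simp add: \<Phi>_def D_def algebra_simps)
  qed
  have "k * D\<^sup>2 \<le> 4 * M"
    using diag M(1)[OF memX(1)] M(1)[OF memX(2)] M(2)[OF memX(1)] M(2)[OF memX(2)] by linarith
  then have "k * D\<^sup>2 < k * d\<^sup>2" using kd by linarith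
  then have "D\<^sup>2 < d\<^sup>2" using k0 by simp
  then have Dd: "D < d" using d by (simp add: power_less_imp_less_base)
  then have uz: "\<bar>u (t, x) - u (s, y)\<bar> < rho" "\<bar>v (t, x) - v (s, y)\<bar> < rho"
    using uc memX by (auto simp: D_def)
  then have kD: "k * D\<^sup>2 \<le> 2 * rho" using diag by linarith

  have "th / 2 \<le> u (t, x) - v (s, y)"
  proof -
    have "0 \<le> eta * (T - t)" "0 \<le> eta * (T - s)" "0 \<le> k * (norm ((t, x) - (s, y)))\<^sup>2 / 2"
      "0 \<le> l * (h x + h y)"
      using mem memU h0[of x] h0[of y] eta k0 l0 by auto
    then show ?thesis using big unfolding \<Phi>_def fst_conv snd_conv by linarith
  qed
  \<comment> \<open>Moving one argument to the other point changes \<open>u\<close> or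
    \<open>v\<close> by less than \<open>rho\<close>, which is at most \<open>th / 4\<close>, so a
    gap of \<open>th / 2\<close> stays positive on the diagonal. The terminal inequality then
    excludes \<open>t = T\<close> and \<open>s = T\<close>.\<close>
  then have "v (t, x) < u (t, x)" "v (s, y) < u (s, y)" using uz rho_th th by linarith+
  then have tsT: "t \<in> {0..<T}" "s \<in> {0..<T}"
    using mem memU terminal[of x] terminal[of y] by (force simp: less_le)+

  define p where "p = k *\<^sub>R (x - y)"
  have "- (k * (t - s) - eta) + K t x (p + l *\<^sub>R dh x) \<le> 0"
  proof -
    have "local_max_on ({0..<T} \<times> U)
      (\<lambda>z. u z - (k * (norm (z - (s, y)))\<^sup>2 / 2 + l * h (snd z) - eta * fst z)) (t, x)"
      unfolding local_max_on_def
    \<comment> \<open>The radius 1 is arbitrary, since the maximum is global.\<close>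
    proof (intro conjI exI[of _ 1] ballI impI)
      fix z assume "z \<in> {0..<T} \<times> U"
      then have "\<Phi> z (s, y) \<le> \<Phi> (t, x) (s, y)" using mem memU by (intro max) auto
      then show "u z - (k * (norm (z - (s, y)))\<^sup>2 / 2 + l * h (snd z) - eta * fst z)
        \<le> u (t, x) - (k * (norm ((t, x) - (s, y)))\<^sup>2 / 2 + l * h (snd (t, x)) - eta * fst (t, x))"
        by (simp add: \<Phi>_def algebra_simps)
    qed (use tsT memU in auto)
    moreover have "C1_test T U
        (\<lambda>z. k * (norm (z - (s, y)))\<^sup>2 / 2 + l * h (snd z) - eta * fst z)
        (\<lambda>z. k * (fst z - s) - eta) (\<lambda>z. k *\<^sub>R (snd z - y) + l *\<^sub>R dh (snd z))"
      using C1_test_quadratic_barrier[where q = "(s, y)" and k = k and l = l and e = eta, OF dh cdh]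
      unfolding fst_conv snd_conv .
    ultimately have "- (k * (fst (t, x) - s) - eta)
        + K t x (k *\<^sub>R (snd (t, x) - y) + l *\<^sub>R dh (snd (t, x))) \<le> 0"
      using sub unfolding viscosity_subsolution_def by blast
    then show ?thesis by (simp add: p_def)
  qed
  moreover have "- (k * (t - s) + eta) + K s y (p - l *\<^sub>R dh y) \<ge> 0"
  proof -
    \<comment> \<open>With the first point frozen, the negated penalties test \<open>v\<close> from
      below. Their time derivative at \<open>(s, y)\<close> is \<open>k * (t - s) + eta\<close> and
      their gradient is \<open>p - l *\<^sub>R dh y\<close>, with the same \<open>p\<close> as for
      \<open>u\<close>.\<close>
    have "local_min_on ({0..<T} \<times> U)
      (\<lambda>z. v z - (- k * (norm (z - (t, x)))\<^sup>2 / 2 + - l * h (snd z) - - eta * fst z)) (s, y)"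
      unfolding local_min_on_def
    proof (intro conjI exI[of _ 1] ballI impI)
      fix z assume "z \<in> {0..<T} \<times> U"
      then have "\<Phi> (t, x) z \<le> \<Phi> (t, x) (s, y)" using mem memU by (intro max) auto
      then show "v (s, y) - (- k * (norm ((s, y) - (t, x)))\<^sup>2 / 2 + - l * h (snd (s, y)) - - eta * fst (s, y))
        \<le> v z - (- k * (norm (z - (t, x)))\<^sup>2 / 2 + - l * h (snd z) - - eta * fst z)"
        unfolding \<Phi>_def norm_minus_commute[of z] norm_minus_commute[of "(s, y)"]
        by (simp add: algebra_simps)
    qed (use tsT memU in auto)
    moreover have "C1_test T U
        (\<lambda>z. - k * (norm (z - (t, x)))\<^sup>2 / 2 + - l * h (snd z) - - eta * fst z)
        (\<lambda>z. - k * (fst z - t) - - eta) (\<lambda>z. - k *\<^sub>R (snd z - x) + - l *\<^sub>R dh (snd z))"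
      using C1_test_quadratic_barrier[where q = "(t, x)" and k = "- k" and l = "- l" and e = "- eta", OF dh cdh]
      unfolding fst_conv snd_conv .
    ultimately have "- (- k * (fst (s, y) - t) - - eta)
        + K s y (- k *\<^sub>R (snd (s, y) - x) + - l *\<^sub>R dh (snd (s, y))) \<ge> 0"
      using super unfolding viscosity_supersolution_def by blast
    moreover have "- k *\<^sub>R (snd (s, y) - x) + - l *\<^sub>R dh (snd (s, y)) = p - l *\<^sub>R dh y"
      by (simp add: p_def algebra_simps)
    ultimately show ?thesis by (simp add: algebra_simps)
  qed
  \<comment> \<open>Subtracting the two viscosity inequalities cancels \<open>k * (t - s)\<close>,
    while the time penalties add up to \<open>2 * eta\<close>.\<close>
  ultimately have "2 * eta \<le> C * ((1 + norm p) * (\<bar>t - s\<bar> + norm (x - y))) + C * l"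
    using struct[OF tsT memU less_imp_le[OF l0], of p] unfolding mult.assoc by linarith
  \<comment> \<open>Since \<open>norm p\<close> is at most \<open>k * D\<close>, the product with
    the distances is at most \<open>2 * (k * D\<^sup>2)\<close>, hence at most
    \<open>4 * rho\<close>; the summand 1 contributes at most \<open>2 * D\<close>, hence
    \<open>2 * rho\<close>.\<close>
  moreover have "C * ((1 + norm p) * (\<bar>t - s\<bar> + norm (x - y))) \<le> C * (6 * rho)"
  proof (rule mult_left_mono)
    have *: "\<bar>t - s\<bar> \<le> D" "norm (x - y) \<le> D"
      using norm_fst_le[of "t - s" "x - y"] norm_snd_le[of "x - y" "t - s"] by (simp_all add: D_def)
    have "norm p * (\<bar>t - s\<bar> + norm (x - y)) \<le> k * D * (D + D)"
    proof (rule mult_mono)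
      show "norm p \<le> k * D" using * k0 by (simp add: p_def)
      show "0 \<le> k * D" using k0 by (simp add: D_def)
    qed (use * in auto)
    also have "\<dots> = 2 * (k * D\<^sup>2)" by (simp add: power2_eq_square)
    finally have "norm p * (\<bar>t - s\<bar> + norm (x - y)) \<le> 4 * rho" using kD by linarith
    then show "(1 + norm p) * (\<bar>t - s\<bar> + norm (x - y)) \<le> 6 * rho"
      using * Dd d unfolding distrib_right mult_1 by linarith
  qed (use C in simp)
  moreover have "C * (6 * rho) \<le> eta" using rhoC by simp
  ultimately show False using lC by linarith
qed

section \<open>Geometry of the simplex in chart coordinates\<close>

lemma sum_UNIV_option:
  "(\<Sum>i\<in>(UNIV :: 'n::finite option set). F i) = (\<Sum>k\<in>UNIV. F (Some k)) + (F None :: real)"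
  by (simp add: UNIV_option_conv sum.reindex add.commute)

lemma sum_check_pt: "(\<Sum>i\<in>UNIV. check_pt x $ i) = 1"
  by (simp add: sum_UNIV_option check_pt_def last_coord_def)

lemma mem_hat_simplex_iff: "x \<in> hat_simplex \<longleftrightarrow> (\<forall>i. 0 \<le> check_pt x $ i)"
  by (auto simp: hat_simplex_def check_pt_def last_coord_def split: option.splits)

lemma check_pt_mem_prob_simplex: "x \<in> hat_simplex \<Longrightarrow> check_pt x \<in> prob_simplex"
  by (simp add: prob_simplex_def mem_hat_simplex_iff sum_check_pt)

lemma prob_simplex_nth_le_1: "m \<in> prob_simplex \<Longrightarrow> m $ i \<le> 1"
  using member_le_sum[of i UNIV "($) m"] by (simp add: prob_simplex_def)

lemma continuous_on_check_pt [continuous_intros]: "continuous_on S (\<lambda>x. check_pt x $ i)"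
  by (cases i) (auto simp: check_pt_def last_coord_def intro!: continuous_intros)

lemma check_pt_affine:
  "check_pt (x + y) $ i = check_pt x $ i + (case i of Some k \<Rightarrow> y $ k | None \<Rightarrow> - (\<Sum>k\<in>UNIV. y $ k))"
  by (cases i) (auto simp: check_pt_def last_coord_def sum.distrib)

text \<open>Transfers Lipschitz bounds from the simplex to the chart. The last coordinate changes by
  at most the sum of the changes of the others, whence the factor 2 in the l1 norm.\<close>

lemma norm_check_pt_diff_le:
  fixes x y :: "real ^ 'n::finite"
  shows "norm (check_pt x - check_pt y) \<le> 2 * real CARD('n) * norm (x - y)"
proof -
  have "norm (check_pt x - check_pt y) \<le> (\<Sum>i\<in>UNIV. \<bar>(check_pt x - check_pt y) $ i\<bar>)"
    by (rule norm_le_l1_cart)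
  also have "\<dots> = (\<Sum>k\<in>UNIV. \<bar>(x - y) $ k\<bar>) + \<bar>\<Sum>k\<in>UNIV. (x - y) $ k\<bar>"
    by (simp add: sum_UNIV_option check_pt_def last_coord_def sum_subtractf abs_minus_commute)
  also have "\<dots> \<le> 2 * (\<Sum>k\<in>UNIV. \<bar>(x - y) $ k\<bar>)"
    using sum_abs[of "\<lambda>k. (x - y) $ k" UNIV] by simp
  also have "(\<Sum>k\<in>UNIV. \<bar>(x - y) $ k\<bar>) \<le> (\<Sum>k\<in>(UNIV :: 'n set). norm (x - y))"
    by (intro sum_mono component_le_norm_cart)
  finally show ?thesis by simp
qed

lemma norm_axis_real: "norm (axis k c :: real ^ 'n::finite) = \<bar>c\<bar>"
proof -
  have "axis k c = c *\<^sub>R (axis k 1 :: real ^ 'n)" by (simp add: axis_def vec_eq_iff)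
  then show ?thesis by simp
qed

text \<open>Strict inequalities define an open set. Conversely, around an interior point there is
  room for a small step that lowers any given mass, so this mass was positive.\<close>

lemma interior_hat_simplex:
  "interior hat_simplex = {x :: real ^ 'n::finite. \<forall>i. 0 < check_pt x $ i}" (is "_ = ?P")
proof
  have "open (\<Inter>i. {x :: real ^ 'n. 0 < check_pt x $ i})"
    by (intro open_INT ballI open_Collect_less continuous_intros) auto
  moreover have "(\<Inter>i. {x. 0 < check_pt x $ i}) = ?P" by auto
  ultimately have "open ?P" by simp
  moreover have "?P \<subseteq> hat_simplex" by (auto simp: mem_hat_simplex_iff less_imp_le)
  ultimately show "?P \<subseteq> interior hat_simplex" by (rule interior_maximal[rotated])
next
  show "interior hat_simplex \<subseteq> ?P"
  proof (intro subsetI CollectI allI)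
    fix x :: "real ^ 'n" and i
    assume "x \<in> interior hat_simplex"
    then obtain e where e: "0 < e" "ball x e \<subseteq> hat_simplex" by (auto simp: mem_interior)
    obtain y where "dist x (x + y) < e"
      and "(case i of Some k \<Rightarrow> y $ k | None \<Rightarrow> - (\<Sum>k\<in>UNIV. y $ k)) < (0 :: real)"
    proof (cases i)
      case None
      \<comment> \<open>Raising any single chart coordinate lowers the last mass;
        \<open>undefined\<close> merely names some index.\<close>
      have "(\<Sum>k\<in>UNIV. (axis undefined (e / 2) :: real ^ 'n) $ k) = e / 2"
        by (simp add: axis_def)
      then show ?thesis
        using that[of "axis undefined (e / 2)"] e None by (simp add: dist_norm norm_axis_real)
    next
      case (Some k)
      show ?thesis
        using that[of "axis k (- e / 2)"] e Some by (simp add: dist_norm norm_axis_real)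
    qed
    moreover from this have "0 \<le> check_pt (x + y) $ i"
      using e by (auto simp: mem_hat_simplex_iff subset_iff)
    ultimately show "0 < check_pt x $ i" by (simp add: check_pt_affine)
  qed
qed

lemma convex_hat_simplex: "convex hat_simplex"
proof (rule convexI)
  fix x y :: "real ^ 'n" and a b :: real
  assume *: "x \<in> hat_simplex" "y \<in> hat_simplex" "0 \<le> a" "0 \<le> b" "a + b = 1"
  have "check_pt (a *\<^sub>R x + b *\<^sub>R y) $ i = a * check_pt x $ i + b * check_pt y $ i" for i
    using *(5)[symmetric]
    by (cases i) (auto simp: check_pt_def last_coord_def sum.distrib sum_distrib_left algebra_simps)
  then show "a *\<^sub>R x + b *\<^sub>R y \<in> hat_simplex" using * by (simp add: mem_hat_simplex_iff)
qed

lemma closed_hat_simplex: "closed (hat_simplex :: (real ^ 'n::finite) set)"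
proof -
  have "closed {x :: real ^ 'n. \<forall>i. 0 \<le> check_pt x $ i}"
    by (intro closed_Collect_all closed_Collect_le continuous_intros)
  moreover have "{x :: real ^ 'n. \<forall>i. 0 \<le> check_pt x $ i} = hat_simplex"
    by (auto simp: mem_hat_simplex_iff)
  ultimately show ?thesis by simp
qed

lemma compact_hat_simplex: "compact (hat_simplex :: (real ^ 'n::finite) set)"
proof -
  have "bounded (hat_simplex :: (real ^ 'n) set)"
  proof (rule boundedI)
    fix x :: "real ^ 'n" assume "x \<in> hat_simplex"
    then show "norm x \<le> 1" using norm_le_l1_cart[of x] by (simp add: hat_simplex_def)
  qed
  then show ?thesis by (simp add: compact_eq_bounded_closed closed_hat_simplex)
qed

text \<open>A convex set with nonempty interior has the same closure as its interior; the witness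
  \<open>c\<close> is the barycentre, where all masses are equal.\<close>

lemma closure_interior_hat_simplex: "closure (interior hat_simplex) = (hat_simplex :: (real ^ 'n::finite) set)"
proof -
  define c :: "real ^ 'n" where "c = (\<chi> k. 1 / (1 + real CARD('n)))"
  have "c \<in> interior hat_simplex"
    by (auto simp: interior_hat_simplex c_def check_pt_def last_coord_def field_simps split: option.splits)
  then show ?thesis
    using convex_closure_interior[OF convex_hat_simplex] closure_closed[OF closed_hat_simplex] by auto
qed

section \<open>The logarithmic barrier\<close>

definition barrier :: "real ^ 'n::finite \<Rightarrow> real" where
  "barrier x = - (\<Sum>i\<in>UNIV. ln (check_pt x $ i))"

text \<open>The term \<open>1 / last_coord x\<close> occurs in every component because the last mass
  decreases with each chart coordinate.\<close>

definition barrier_grad :: "real ^ 'n::finite \<Rightarrow> real ^ 'n" where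
  "barrier_grad x = (\<chi> k. 1 / last_coord x - 1 / x $ k)"

lemma GDERIV_barrier:
  fixes x :: "real ^ 'n::finite"
  assumes "x \<in> interior hat_simplex"
  shows "GDERIV barrier x :> barrier_grad x"
proof -
  have pos: "0 < x $ k" "0 < 1 - (\<Sum>k\<in>UNIV. x $ k)" for k
    using assms spec[of "\<lambda>i. 0 < check_pt x $ i" "Some k"] spec[of "\<lambda>i. 0 < check_pt x $ i" None]
    by (auto simp: interior_hat_simplex check_pt_def last_coord_def)
  have eq: "barrier = (\<lambda>x :: real ^ 'n. - (\<Sum>k\<in>UNIV. ln (x $ k)) - ln (1 - (\<Sum>k\<in>UNIV. x $ k)))"
    by (simp add: fun_eq_iff barrier_def sum_UNIV_option check_pt_def last_coord_def)
  note [derivative_intros] = bounded_linear.has_derivative[OF bounded_linear_vec_nth]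
  show ?thesis
    unfolding eq gderiv_def barrier_grad_def
    by (rule derivative_eq_intros refl pos)+
      (simp add: fun_eq_iff inner_vec_def last_coord_def sum_subtractf sum_distrib_right
        divide_inverse algebra_simps)
qed

lemma continuous_on_barrier_grad:
  "continuous_on (interior hat_simplex :: (real ^ 'n::finite) set) barrier_grad"
proof -
  have "x $ k \<noteq> 0" "last_coord x \<noteq> 0" if "x \<in> interior hat_simplex" for x :: "real ^ 'n" and k
    using that spec[of "\<lambda>i. 0 < check_pt x $ i" "Some k"] spec[of "\<lambda>i. 0 < check_pt x $ i" None]
    by (auto simp: interior_hat_simplex check_pt_def)
  moreover have "continuous_on S last_coord" for S :: "(real ^ 'n) set"
    unfolding last_coord_def by (intro continuous_intros)
  ultimately show ?thesis
    unfolding barrier_grad_def by (intro continuous_intros) blast+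
qed

lemma ln_check_pt_nonpos:
  assumes "x \<in> interior hat_simplex"
  shows "ln (check_pt x $ i) \<le> 0"
proof -
  have "check_pt x \<in> prob_simplex"
    using assms interior_subset check_pt_mem_prob_simplex by blast
  then show ?thesis
    using assms prob_simplex_nth_le_1[of "check_pt x" i] by (simp add: interior_hat_simplex)
qed

lemma barrier_nonneg: "x \<in> interior hat_simplex \<Longrightarrow> 0 \<le> barrier x"
  by (simp add: barrier_def sum_nonpos ln_check_pt_nonpos del: ln_le_zero_iff)

text \<open>All summands of the barrier are nonnegative, so a bound \<open>c\<close> on the sum
  bounds each one and keeps every mass at least \<open>exp (- c)\<close>. The points with such
  masses form a compact subset of the interior, on which the barrier is continuous.\<close>

lemma compact_barrier_sublevel:
  "compact {x \<in> interior hat_simplex :: (real ^ 'n::finite) set. barrier x \<le> c}"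
proof -
  define S where "S = {x :: real ^ 'n. \<forall>i. exp (- c) \<le> check_pt x $ i}"
  have SI: "S \<subseteq> interior hat_simplex"
    by (force simp: S_def interior_hat_simplex intro: less_le_trans[OF exp_gt_zero])
  have "closed S"
    unfolding S_def by (intro closed_Collect_all closed_Collect_le continuous_intros)
  moreover have "S \<subseteq> hat_simplex" using SI interior_subset by blast
  ultimately have "compact S"
    using compact_Int_closed[OF compact_hat_simplex, of S] by (simp add: Int_absorb1)
  moreover have "continuous_on S barrier"
    using GDERIV_barrier SI
    by (intro continuous_at_imp_continuous_on ballI has_derivative_continuous) (auto simp: gderiv_def)
  then have "closed {x \<in> S. barrier x \<le> c}"
    using \<open>closed S\<close> by (intro continuous_on_closed_Collect_le continuous_on_const)
  ultimately have "compact (S \<inter> {x \<in> S. barrier x \<le> c})" by (rule compact_Int_closed)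
  moreover have "{x \<in> interior hat_simplex. barrier x \<le> c} = S \<inter> {x \<in> S. barrier x \<le> c}"
  proof -
    have "exp (- c) \<le> check_pt x $ i" if x: "x \<in> interior hat_simplex" "barrier x \<le> c" for x i
    proof -
      have "- ln (check_pt x $ i) \<le> barrier x"
        unfolding barrier_def sum_negf[symmetric]
        using ln_check_pt_nonpos[OF x(1)] by (intro member_le_sum) auto
      then have "- c \<le> ln (check_pt x $ i)" using x by simp
      then show ?thesis using x(1) by (simp add: interior_hat_simplex ln_ge_iff)
    qed
    then show ?thesis using SI by (auto simp: S_def)
  qed
  ultimately show ?thesis by simp
qed

section \<open>The Hamiltonian as a maximum over action profiles\<close>

text \<open>In terms of the momentum \<open>w\<close>, \<open>extend0 w\<close> appends the coordinate 0 for the last state, so that the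
  vectors \<open>(w\<^sub>1 - w\<^sub>i, \<dots>, - w\<^sub>i)\<close> and \<open>(w\<^sub>1, \<dots>, 0)\<close> in the Hamiltonians are all differences
  \<open>extend0 w $ j - extend0 w $ i\<close>.\<close>

definition extend0 :: "real ^ 'n::finite \<Rightarrow> real ^ 'n option" where
  "extend0 w = (\<chi> i. case i of Some k \<Rightarrow> w $ k | None \<Rightarrow> 0)"

text \<open>The rate of change of the pairing of \<open>extend0 w\<close> with \<open>m\<close> when
  mass moves from state \<open>i\<close> to state \<open>j\<close> at rate
  \<open>m $ i * Q i j\<close>. The diagonal rates drop out, as the difference vanishes for
  \<open>i = j\<close>.\<close>

definition drift_term ::
  "('n::finite option \<Rightarrow> 'n option \<Rightarrow> real \<Rightarrow> 'a \<Rightarrow> real ^ 'n option \<Rightarrow> real) \<Rightarrow>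
   real \<Rightarrow> 'a ^ 'n option \<Rightarrow> real ^ 'n option \<Rightarrow> real ^ 'n \<Rightarrow> real" where
  "drift_term Q t a m w =
     (\<Sum>i\<in>UNIV. \<Sum>j\<in>UNIV. m $ i * Q i j t (a $ i) m * (extend0 w $ j - extend0 w $ i))"

lemma total_hamiltonian_eq:
  "total_hamiltonian A Q f t x w = (\<Sum>i\<in>UNIV. check_pt x $ i *
     hamiltonian A Q f i t (check_pt x) (\<chi> j. extend0 w $ j - extend0 w $ i))"
proof -
  have "(\<chi> j. extend0 w $ j - extend0 w $ Some k)
      = (\<chi> j. case j of Some l \<Rightarrow> w $ l - w $ k | None \<Rightarrow> - w $ k)" for k
    by (auto simp: extend0_def vec_eq_iff split: option.splits)
  moreover have "(\<chi> j. extend0 w $ j - extend0 w $ None)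
      = (\<chi> j. case j of Some l \<Rightarrow> w $ l | None \<Rightarrow> 0)"
    by (auto simp: extend0_def vec_eq_iff split: option.splits)
  ultimately show ?thesis
    by (simp add: total_hamiltonian_def hat_hamiltonian_def sum_UNIV_option check_pt_def)
qed

text \<open>Weighting by the masses merges the single costs into \<open>run_cost\<close>, for which
  a Lipschitz bound is available.\<close>

lemma sum_ham_integrand:
  "(\<Sum>i\<in>UNIV. m $ i * ham_integrand Q f i t m (\<chi> j. extend0 w $ j - extend0 w $ i) (a $ i))
    = - drift_term Q t a m w - run_cost f t a m"
  by (simp add: ham_integrand_def drift_term_def run_cost_def inner_vec_def right_diff_distrib
      sum_subtractf sum_negf sum_distrib_left mult.assoc)

text \<open>The maximum is taken state by state with positive weights, so every profile gives a
  lower bound.\<close>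

lemma total_hamiltonian_ge:
  assumes A: "assumption_A A T Q f g" and t: "t \<in> {0..T}" and x: "x \<in> interior hat_simplex"
    and a: "a \<in> action_profiles A"
  shows "- drift_term Q t a (check_pt x) w - run_cost f t a (check_pt x) \<le> total_hamiltonian A Q f t x w"
  unfolding sum_ham_integrand[symmetric] total_hamiltonian_eq
proof (rule sum_mono)
  fix i
  have m: "check_pt x \<in> prob_simplex" using x interior_subset check_pt_mem_prob_simplex by blast
  have pos: "0 < check_pt x $ i" using x by (simp add: interior_hat_simplex)
  have "a $ i \<in> A" using a by (simp add: action_profiles_def)
  then show "check_pt x $ i * ham_integrand Q f i t (check_pt x) (\<chi> j. extend0 w $ j - extend0 w $ i) (a $ i)
    \<le> check_pt x $ i * hamiltonian A Q f i t (check_pt x) (\<chi> j. extend0 w $ j - extend0 w $ i)"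
    using hamiltonian_is_max[OF A t m pos] pos by (metis less_imp_le mult_left_mono)
qed

text \<open>The summand of state \<open>i\<close> depends on the profile only through its entry
  \<open>i\<close>, so maximisers of the single states combine into one optimal profile.\<close>

lemma total_hamiltonian_attained:
  assumes A: "assumption_A A T Q f g" and t: "t \<in> {0..T}" and x: "x \<in> interior hat_simplex"
  shows "\<exists>a\<in>action_profiles A. total_hamiltonian A Q f t x w
    = - drift_term Q t a (check_pt x) w - run_cost f t a (check_pt x)"
proof -
  have m: "check_pt x \<in> prob_simplex" using x interior_subset check_pt_mem_prob_simplex by blast
  have "\<exists>b\<in>A. hamiltonian A Q f i t (check_pt x) (\<chi> j. extend0 w $ j - extend0 w $ i)
      = ham_integrand Q f i t (check_pt x) (\<chi> j. extend0 w $ j - extend0 w $ i) b" for i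
    using hamiltonian_is_max[OF A t m, of i "\<chi> j. extend0 w $ j - extend0 w $ i"] x
    by (auto simp: interior_hat_simplex)
  then obtain b where b: "\<And>i. b i \<in> A"
    "\<And>i. hamiltonian A Q f i t (check_pt x) (\<chi> j. extend0 w $ j - extend0 w $ i)
      = ham_integrand Q f i t (check_pt x) (\<chi> j. extend0 w $ j - extend0 w $ i) (b i)"
    by metis
  have "total_hamiltonian A Q f t x w
      = - drift_term Q t (\<chi> i. b i) (check_pt x) w - run_cost f t (\<chi> i. b i) (check_pt x)"
    unfolding sum_ham_integrand[symmetric] total_hamiltonian_eq by (simp add: b)
  moreover have "(\<chi> i. b i) \<in> action_profiles A" using b(1) by (simp add: action_profiles_def)
  ultimately show ?thesis by blast
qed

section \<open>Estimates for the drift and the structure condition\<close>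

lemma drift_term_add_scaleR:
  "drift_term Q t a m (v + c *\<^sub>R w) = drift_term Q t a m v + c * drift_term Q t a m w"
proof -
  have "extend0 (v + c *\<^sub>R w) $ i = extend0 v $ i + c * extend0 w $ i" for i
    by (simp add: extend0_def split: option.splits)
  then show ?thesis
    by (simp add: drift_term_def sum_distrib_left sum.distrib[symmetric] algebra_simps)
qed

lemma abs_extend0_le: "\<bar>extend0 w $ i\<bar> \<le> norm w"
  using component_le_norm_cart by (auto simp: extend0_def split: option.splits)

lemma prob_simplex_compact: "compact (prob_simplex :: (real ^ 'i::finite) set)"
proof -
  have "closed (prob_simplex :: (real ^ 'i) set)"
    unfolding prob_simplex_def
    by (intro closed_Collect_conj closed_Collect_all closed_Collect_le closed_Collect_eq continuous_intros)
  moreover have "bounded (prob_simplex :: (real ^ 'i) set)"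
  proof (rule boundedI)
    fix m :: "real ^ 'i" assume "m \<in> prob_simplex"
    then show "norm m \<le> 1" using norm_le_l1_cart[of m] by (simp add: prob_simplex_def)
  qed
  ultimately show ?thesis by (simp add: compact_eq_bounded_closed)
qed

lemma transition_rates_bounded:
  assumes "assumption_A A T Q f g"
  shows "\<exists>B. \<forall>i j. \<forall>t\<in>{0..T}. \<forall>a\<in>A. \<forall>m\<in>prob_simplex. \<bar>Q i j t a m\<bar> \<le> B"
proof -
  have cpt: "compact ({0..T} \<times> A \<times> (prob_simplex :: (real ^ 'b) set))"
    using assms by (intro compact_Times prob_simplex_compact) (auto simp: assumption_A_def)
  have "\<exists>B. \<forall>t\<in>{0..T}. \<forall>a\<in>A. \<forall>m\<in>prob_simplex. \<bar>Q i j t a m\<bar> \<le> B" for i j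
  proof -
    have "continuous_on ({0..T} \<times> A \<times> prob_simplex) (\<lambda>(t, a, m). Q i j t a m)"
      using assms by (simp add: assumption_A_def)
    from compact_imp_bounded[OF compact_continuous_image[OF this cpt]] show ?thesis
      unfolding bounded_iff by fastforce
  qed
  then obtain B where B: "\<And>i j t a m. \<lbrakk>t \<in> {0..T}; a \<in> A; m \<in> prob_simplex\<rbrakk> \<Longrightarrow> \<bar>Q i j t a m\<bar> \<le> B i j"
    by metis
  have "B i j \<le> (\<Sum>i\<in>UNIV. \<Sum>j\<in>UNIV. \<bar>B i j\<bar>)" for i j
  proof -
    have "B i j \<le> (\<Sum>j\<in>UNIV. \<bar>B i j\<bar>)"
      using member_le_sum[of j UNIV "\<lambda>j. \<bar>B i j\<bar>"] by simp
    also have "\<dots> \<le> (\<Sum>i\<in>UNIV. \<Sum>j\<in>UNIV. \<bar>B i j\<bar>)"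
      using member_le_sum[of i UNIV "\<lambda>i. \<Sum>j\<in>UNIV. \<bar>B i j\<bar>"] by (simp add: sum_nonneg)
    finally show ?thesis .
  qed
  then show ?thesis using B by (meson order_trans)
qed

text \<open>Each coefficient \<open>m $ i * Q i j\<close> is a product of bounded Lipschitz
  functions, and the momentum enters linearly.\<close>

lemma drift_term_lipschitz:
  assumes A: "assumption_A A T Q f g"
  shows "\<exists>C\<ge>0. \<forall>a\<in>action_profiles A. \<forall>t\<in>{0..T}. \<forall>s\<in>{0..T}. \<forall>m\<in>prob_simplex. \<forall>p\<in>prob_simplex. \<forall>w.
    \<bar>drift_term Q t a m w - drift_term Q s a p w\<bar> \<le> C * (\<bar>t - s\<bar> + norm (m - p)) * norm w"
proof -
  obtain B where B: "\<And>i j t a m. \<lbrakk>t \<in> {0..T}; a \<in> A; m \<in> prob_simplex\<rbrakk> \<Longrightarrow> \<bar>Q i j t a m\<bar> \<le> B"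
    using transition_rates_bounded[OF A] by metis
  obtain L where L: "\<And>i j a t s m p. \<lbrakk>a \<in> A; t \<in> {0..T}; s \<in> {0..T}; m \<in> prob_simplex; p \<in> prob_simplex\<rbrakk>
      \<Longrightarrow> \<bar>Q i j t a m - Q i j s a p\<bar> \<le> L * (\<bar>t - s\<bar> + norm (m - p))"
    using A unfolding assumption_A_def by meson
  define c where "c = real CARD('b option)"
  show ?thesis
  \<comment> \<open>The factors \<open>c\<close> count the pairs of states, the sum of
    \<open>L\<close> and \<open>B\<close> in absolute value is the Lipschitz constant of a
    coefficient, and 2 comes from the difference of two momentum entries.\<close>
  proof (intro exI[of _ "c * (c * ((\<bar>L\<bar> + \<bar>B\<bar>) * 2))"] conjI ballI allI)
    fix a :: "'a ^ 'b option" and t s and m p :: "real ^ 'b option" and w :: "real ^ 'b"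
    assume h: "a \<in> action_profiles A" "t \<in> {0..T}" "s \<in> {0..T}" "m \<in> prob_simplex" "p \<in> prob_simplex"
    define r where "r = \<bar>t - s\<bar> + norm (m - p)"
    have r: "0 \<le> r" by (simp add: r_def)
    have "\<bar>drift_term Q t a m w - drift_term Q s a p w\<bar>
      = \<bar>\<Sum>i\<in>UNIV. \<Sum>j\<in>UNIV. (m $ i * Q i j t (a $ i) m - p $ i * Q i j s (a $ i) p) *
          (extend0 w $ j - extend0 w $ i)\<bar>"
      by (simp add: drift_term_def sum_subtractf[symmetric] left_diff_distrib)
    also have "\<dots> \<le> (\<Sum>i\<in>UNIV. \<Sum>j\<in>UNIV. \<bar>(m $ i * Q i j t (a $ i) m - p $ i * Q i j s (a $ i) p) *
          (extend0 w $ j - extend0 w $ i)\<bar>)"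
      by (rule order_trans[OF sum_abs sum_mono[OF sum_abs]])
    also have "\<dots> \<le> (\<Sum>i\<in>(UNIV :: 'b option set). \<Sum>j\<in>(UNIV :: 'b option set).
        ((\<bar>L\<bar> + \<bar>B\<bar>) * r) * (2 * norm w))"
    proof (intro sum_mono)
      fix i j :: "'b option"
      have ai: "a $ i \<in> A" using h(1) by (simp add: action_profiles_def)
      have "\<bar>Q i j t (a $ i) m - Q i j s (a $ i) p\<bar> \<le> \<bar>L\<bar> * r"
        using L[OF ai h(2-5), of i j] r unfolding r_def
        by (meson abs_ge_self mult_right_mono order_trans)
      moreover have "\<bar>m $ i\<bar> \<le> 1"
        using h(4) prob_simplex_nth_le_1[OF h(4)] by (auto simp: prob_simplex_def)
      ultimately have 1: "\<bar>m $ i * (Q i j t (a $ i) m - Q i j s (a $ i) p)\<bar> \<le> 1 * (\<bar>L\<bar> * r)"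
        unfolding abs_mult by (intro mult_mono) auto
      have "\<bar>m $ i - p $ i\<bar> \<le> r"
        using component_le_norm_cart[of "m - p" i] by (simp add: r_def)
      moreover have "\<bar>Q i j s (a $ i) p\<bar> \<le> \<bar>B\<bar>"
        using B[OF h(3) ai h(5), of i j] by simp
      ultimately have 2: "\<bar>(m $ i - p $ i) * Q i j s (a $ i) p\<bar> \<le> r * \<bar>B\<bar>"
        unfolding abs_mult using r by (intro mult_mono) auto
      have "m $ i * Q i j t (a $ i) m - p $ i * Q i j s (a $ i) p =
          m $ i * (Q i j t (a $ i) m - Q i j s (a $ i) p) + (m $ i - p $ i) * Q i j s (a $ i) p"
        by (simp add: algebra_simps)
      then have 3: "\<bar>m $ i * Q i j t (a $ i) m - p $ i * Q i j s (a $ i) p\<bar> \<le> (\<bar>L\<bar> + \<bar>B\<bar>) * r"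
        using 1 2 by (simp add: algebra_simps)
      have "\<bar>extend0 w $ j - extend0 w $ i\<bar> \<le> 2 * norm w"
        using abs_extend0_le[of w i] abs_extend0_le[of w j] by linarith
      then show "\<bar>(m $ i * Q i j t (a $ i) m - p $ i * Q i j s (a $ i) p) * (extend0 w $ j - extend0 w $ i)\<bar>
          \<le> ((\<bar>L\<bar> + \<bar>B\<bar>) * r) * (2 * norm w)"
        unfolding abs_mult using 3 r by (intro mult_mono) auto
    qed
    also have "\<dots> = c * (c * ((\<bar>L\<bar> + \<bar>B\<bar>) * 2)) * r * norm w"
      by (simp add: c_def)
    finally show "\<bar>drift_term Q t a m w - drift_term Q s a p w\<bar>
      \<le> c * (c * ((\<bar>L\<bar> + \<bar>B\<bar>) * 2)) * (\<bar>t - s\<bar> + norm (m - p)) * norm w"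
      by (simp add: r_def)
  qed (simp add: c_def)
qed

text \<open>Only an upper bound holds. The dangerous \<open>1 / m $ i\<close> is multiplied by the
  outflow weight \<open>m $ i\<close>, leaving a bounded rate; the possibly huge
  \<open>1 / m $ j\<close> enters with a negative sign because the rates are nonnegative.\<close>

lemma drift_term_barrier_bounded:
  assumes A: "assumption_A A T Q f g" and Q: "transition_rates A T Q"
  shows "\<exists>C\<ge>0. \<forall>a\<in>action_profiles A. \<forall>t\<in>{0..T}. \<forall>x\<in>interior hat_simplex.
    drift_term Q t a (check_pt x) (barrier_grad x) \<le> C"
proof -
  obtain B where B: "\<And>i j t a m. \<lbrakk>t \<in> {0..T}; a \<in> A; m \<in> prob_simplex\<rbrakk> \<Longrightarrow> \<bar>Q i j t a m\<bar> \<le> B"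
    using transition_rates_bounded[OF A] by metis
  define c where "c = real CARD('b option)"
  show ?thesis
  proof (intro exI[of _ "c * (c * \<bar>B\<bar>)"] conjI ballI)
    fix a :: "'a ^ 'b option" and t and x :: "real ^ 'b"
    assume h: "a \<in> action_profiles A" "t \<in> {0..T}" "x \<in> interior hat_simplex"
    define m where "m = check_pt x"
    have m: "m \<in> prob_simplex"
      using h(3) interior_subset check_pt_mem_prob_simplex unfolding m_def by blast
    \<comment> \<open>The common term \<open>1 / m $ None\<close> cancels in differences and makes
      the formula cover the last state as well.\<close>
    have grad: "extend0 (barrier_grad x) $ i = 1 / m $ None - 1 / m $ i" for i
      by (simp add: m_def extend0_def barrier_grad_def check_pt_def split: option.splits)
    have "drift_term Q t a m (barrier_grad x) \<le> (\<Sum>i\<in>(UNIV :: 'b option set). \<Sum>j\<in>(UNIV :: 'b option set). \<bar>B\<bar>)"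
      unfolding drift_term_def
    proof (intro sum_mono)
      fix i j :: "'b option"
      have ai: "a $ i \<in> A" using h(1) by (simp add: action_profiles_def)
      have pos: "0 < m $ i" "0 < m $ j" using h(3) by (auto simp: m_def interior_hat_simplex)
      have q: "0 \<le> Q i j t (a $ i) m" "Q i j t (a $ i) m \<le> B"
        using Q ai h(2) m B[OF h(2) ai m, of i j] by (auto simp: transition_rates_def)
      have "m $ i * Q i j t (a $ i) m * (extend0 (barrier_grad x) $ j - extend0 (barrier_grad x) $ i)
          = Q i j t (a $ i) m - m $ i / m $ j * Q i j t (a $ i) m"
        using pos by (simp add: grad field_simps)
      also have "\<dots> \<le> \<bar>B\<bar>"
      proof -
        have "0 \<le> m $ i / m $ j * Q i j t (a $ i) m" using pos q by simp
        then show ?thesis using q by linarith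
      qed
      finally show "m $ i * Q i j t (a $ i) m * (extend0 (barrier_grad x) $ j - extend0 (barrier_grad x) $ i)
          \<le> \<bar>B\<bar>" .
    qed
    then show "drift_term Q t a (check_pt x) (barrier_grad x) \<le> c * (c * \<bar>B\<bar>)"
      by (simp add: m_def c_def)
  qed (simp add: c_def)
qed

text \<open>Verifies the structure condition of \<open>comparison_with_barrier\<close>. A profile
  optimal at \<open>(s, y)\<close> is a competitor at \<open>(t, x)\<close>, which reduces the
  difference of Hamiltonians to drift and cost under one common profile.\<close>

lemma total_hamiltonian_structure:
  fixes Q :: "'n::finite option \<Rightarrow> 'n option \<Rightarrow> real \<Rightarrow> 'a::metric_space \<Rightarrow> real ^ 'n option \<Rightarrow> real"
  assumes A: "assumption_A A T Q f g" and Q: "transition_rates A T Q"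
  obtains C where "0 \<le> C"
    and "\<And>t s x y p (l :: real). \<lbrakk>t \<in> {0..T}; s \<in> {0..T}; x \<in> interior hat_simplex; y \<in> interior hat_simplex; 0 \<le> l\<rbrakk> \<Longrightarrow>
      total_hamiltonian A Q f s y (p - l *\<^sub>R barrier_grad y)
        - total_hamiltonian A Q f t x (p + l *\<^sub>R barrier_grad x)
      \<le> C * (1 + norm p) * (\<bar>t - s\<bar> + norm (x - y)) + C * l"
proof -
  obtain C1 where C1: "0 \<le> C1"
    "\<And>a t s m p w. \<lbrakk>a \<in> action_profiles A; t \<in> {0..T}; s \<in> {0..T}; m \<in> prob_simplex; p \<in> prob_simplex\<rbrakk>
      \<Longrightarrow> \<bar>drift_term Q t a m w - drift_term Q s a p w\<bar> \<le> C1 * (\<bar>t - s\<bar> + norm (m - p)) * norm w"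
    using drift_term_lipschitz[OF A] by metis
  obtain C2 where C2: "0 \<le> C2"
    "\<And>a t x. \<lbrakk>a \<in> action_profiles A; t \<in> {0..T}; x \<in> interior hat_simplex\<rbrakk>
      \<Longrightarrow> drift_term Q t a (check_pt x) (barrier_grad x) \<le> C2"
    using drift_term_barrier_bounded[OF A Q] by metis
  obtain C3' where "\<And>a t s m p. \<lbrakk>a \<in> action_profiles A; t \<in> {0..T}; s \<in> {0..T}; m \<in> prob_simplex; p \<in> prob_simplex\<rbrakk>
      \<Longrightarrow> \<bar>run_cost f t a m - run_cost f s a p\<bar> \<le> C3' * (\<bar>t - s\<bar> + norm (m - p))"
    using A unfolding assumption_A_def by meson
  then have C3: "\<bar>run_cost f t a m - run_cost f s a p\<bar> \<le> \<bar>C3'\<bar> * (\<bar>t - s\<bar> + norm (m - p))"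
    if "a \<in> action_profiles A" "t \<in> {0..T}" "s \<in> {0..T}" "m \<in> prob_simplex" "p \<in> prob_simplex" for a t s m p
    using that by (meson abs_ge_self abs_ge_zero add_nonneg_nonneg mult_right_mono norm_ge_zero order_trans)
  define N where "N = 2 * real CARD('n)"
  have N: "1 \<le> N" unfolding N_def using zero_less_card_finite[where 'a = 'n] by linarith
  \<comment> \<open>\<open>N\<close> converts distances of simplex points into chart distances;
    \<open>2 * C2\<close> pays for the barrier gradients at the two points.\<close>
  define C where "C = (C1 + \<bar>C3'\<bar>) * N + 2 * C2"
  have C0: "0 \<le> (C1 + \<bar>C3'\<bar>) * N" "0 \<le> C" using C1 C2 N by (auto simp: C_def)
  show thesis
  proof (rule that[OF C0(2)])
    fix t s and x y p :: "real ^ 'n" and l :: real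
    assume h: "t \<in> {0..T}" "s \<in> {0..T}" "x \<in> interior hat_simplex" "y \<in> interior hat_simplex" "0 \<le> l"
    have m: "check_pt x \<in> prob_simplex" "check_pt y \<in> prob_simplex"
      using h interior_subset check_pt_mem_prob_simplex by blast+
    obtain a where a: "a \<in> action_profiles A"
      "total_hamiltonian A Q f s y (p - l *\<^sub>R barrier_grad y)
        = - drift_term Q s a (check_pt y) (p - l *\<^sub>R barrier_grad y) - run_cost f s a (check_pt y)"
      using total_hamiltonian_attained[OF A h(2,4)] by metis
    define r where "r = \<bar>t - s\<bar> + norm (x - y)"
    define r' where "r' = \<bar>t - s\<bar> + norm (check_pt x - check_pt y)"
    have r: "0 \<le> r" "0 \<le> r'" by (auto simp: r_def r'_def)
    have rr: "r' \<le> N * r"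
    proof -
      have "1 * \<bar>t - s\<bar> \<le> N * \<bar>t - s\<bar>" using N by (intro mult_right_mono) auto
      then show ?thesis
        using norm_check_pt_diff_le[of x y] by (simp add: r_def r'_def N_def distrib_left)
    qed
    have "total_hamiltonian A Q f s y (p - l *\<^sub>R barrier_grad y)
        - total_hamiltonian A Q f t x (p + l *\<^sub>R barrier_grad x)
      \<le> drift_term Q t a (check_pt x) (p + l *\<^sub>R barrier_grad x)
        - drift_term Q s a (check_pt y) (p - l *\<^sub>R barrier_grad y)
        + (run_cost f t a (check_pt x) - run_cost f s a (check_pt y))"
      using total_hamiltonian_ge[OF A h(1,3) a(1), of "p + l *\<^sub>R barrier_grad x"] a(2) by linarith
    \<comment> \<open>Linearity in the momentum gives both barrier contributions a positive factor
      \<open>l\<close>, so the one-sided bound \<open>C2\<close> applies to each.\<close>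
    also have "\<dots> = (drift_term Q t a (check_pt x) p - drift_term Q s a (check_pt y) p)
        + l * drift_term Q t a (check_pt x) (barrier_grad x)
        + l * drift_term Q s a (check_pt y) (barrier_grad y)
        + (run_cost f t a (check_pt x) - run_cost f s a (check_pt y))"
      using drift_term_add_scaleR[of Q s a "check_pt y" p "- l" "barrier_grad y"]
      by (simp add: drift_term_add_scaleR)
    also have "\<dots> \<le> C1 * r' * norm p + l * C2 + l * C2 + \<bar>C3'\<bar> * r'"
      using C1(2)[OF a(1) h(1,2) m, of p] C3[OF a(1) h(1,2) m]
        mult_left_mono[OF C2(2)[OF a(1) h(1,3)] h(5)] mult_left_mono[OF C2(2)[OF a(1) h(2,4)] h(5)]
      unfolding r'_def by linarith
    also have "\<dots> \<le> (C1 + \<bar>C3'\<bar>) * (1 + norm p) * r' + 2 * C2 * l"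
      using C1(1) r by (simp add: algebra_simps)
    also have "\<dots> \<le> (C1 + \<bar>C3'\<bar>) * (1 + norm p) * (N * r) + C * l"
      using C1(1) h(5) C0 by (intro add_mono mult_left_mono mult_right_mono rr) (auto simp: C_def)
    also have "(C1 + \<bar>C3'\<bar>) * (1 + norm p) * (N * r) = ((C1 + \<bar>C3'\<bar>) * N) * ((1 + norm p) * r)"
      by simp
    also have "\<dots> \<le> C * ((1 + norm p) * r)"
      using C2 r by (intro mult_right_mono) (auto simp: C_def)
    finally show "total_hamiltonian A Q f s y (p - l *\<^sub>R barrier_grad y)
        - total_hamiltonian A Q f t x (p + l *\<^sub>R barrier_grad x)
      \<le> C * (1 + norm p) * (\<bar>t - s\<bar> + norm (x - y)) + C * l"
      by (simp add: r_def mult.assoc)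
  qed
qed

section \<open>Comparison on the whole simplex\<close>

theorem theorem17:
  fixes A :: "'a::metric_space set"
    and T :: real
    and Q :: "'n::finite option \<Rightarrow> 'n option \<Rightarrow> real \<Rightarrow> 'a \<Rightarrow> real ^ 'n option \<Rightarrow> real"
    and f :: "'n option \<Rightarrow> real \<Rightarrow> 'a \<Rightarrow> real ^ 'n option \<Rightarrow> real"
    and g :: "'n option \<Rightarrow> real ^ 'n option \<Rightarrow> real"
    and u v :: "real \<times> (real ^ 'n) \<Rightarrow> real"
  assumes "0 < T"
    and "transition_rates A T Q"
    and "assumption_A A T Q f g"
    and "continuous_on ({0..T} \<times> hat_simplex) u"
    and "continuous_on ({0..T} \<times> hat_simplex) v"
    and "viscosity_subsolution T (interior hat_simplex) (total_hamiltonian A Q f) u"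
    and "viscosity_supersolution T (interior hat_simplex) (total_hamiltonian A Q f) v"
    and "\<forall>x\<in>hat_simplex. u (T, x) \<le> v (T, x)"
  shows "\<forall>t\<in>{0..T}. \<forall>x\<in>hat_simplex. u (t, x) \<le> v (t, x)"
proof (intro ballI)
  fix t x assume t: "t \<in> {0..T}" and x: "x \<in> (hat_simplex :: (real ^ 'n) set)"
  have int: "u (t, y) \<le> v (t, y)" if y: "y \<in> interior hat_simplex" for y
  proof (rule total_hamiltonian_structure[OF assms(3,2)])
    fix C
    assume C: "0 \<le> C"
      "\<And>t s x y p (l :: real). \<lbrakk>t \<in> {0..T}; s \<in> {0..T}; x \<in> interior hat_simplex; y \<in> interior hat_simplex; 0 \<le> l\<rbrakk> \<Longrightarrow>
        total_hamiltonian A Q f s y (p - l *\<^sub>R barrier_grad y)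
          - total_hamiltonian A Q f t x (p + l *\<^sub>R barrier_grad x)
        \<le> C * (1 + norm p) * (\<bar>t - s\<bar> + norm (x - y)) + C * l"
    show ?thesis
    proof (rule comparison_with_barrier[OF assms(1) compact_hat_simplex interior_subset assms(4-7)
          _ GDERIV_barrier continuous_on_barrier_grad barrier_nonneg compact_barrier_sublevel C(1) C(2) t y])
      show "u (T, x) \<le> v (T, x)" if "x \<in> interior hat_simplex" for x
        using assms(8) that interior_subset by blast
    qed simp_all
  qed
  have pair: "continuous_on hat_simplex (\<lambda>y. (t, y))" "(\<lambda>y. (t, y)) ` hat_simplex \<subseteq> {0..T} \<times> hat_simplex"
    using t by (auto intro: continuous_on_Pair continuous_on_const continuous_on_id)
  have "continuous_on hat_simplex (\<lambda>y. u (t, y) - v (t, y))"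
    by (rule continuous_on_diff continuous_on_compose2[OF assms(4) pair]
        continuous_on_compose2[OF assms(5) pair])+
  then have "continuous_on (closure (interior hat_simplex)) (\<lambda>y. u (t, y) - v (t, y))"
    by (simp only: closure_interior_hat_simplex)
  moreover have "x \<in> closure (interior hat_simplex)"
    using x by (simp only: closure_interior_hat_simplex)
  ultimately have "u (t, x) - v (t, x) \<le> 0"
    by (rule continuous_le_on_closure) (simp add: int)
  then show "u (t, x) \<le> v (t, x)" by simp
qed

end
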